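(* If $A\in\mathbb{M}_n^+$ has diagonal entries all greater than or equal to $1$, then $$\|A\circ Z\|_!\ge\|Z\|_!$$ holds for all $Z\in\mathbb{M}_n^+$ and all symmetric anti-norms $\|\cdot\|_!$ on $\mathbb{M}_n^+$.
   Context: $\mathbb{M}_n^+$ is the set of positive semidefinite $n\times n$ complex matrices and $A\circ Z$ is the Schur (entrywise) product. A symmetric anti-norm on $\mathbb{M}_n^+$ is a non-negative continuous functional $\|\cdot\|_!$ on $\mathbb{M}_n^+$ such that (1) $\|\lambda A\|_!=\lambda\|A\|_!$ for all $A\in\mathbb{M}_n^+$ and reals $\lambda\ge0$; (2) $\|A\|_!=\|UAU^*\|_!$ for all $A\in\mathbb{M}_n^+$ and unitaries $U$; (3) $\|A+B\|_!\ge\|A\|_!+\|B\|_!$ for all $A,B\in\mathbb{M}_n^+$. *)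

theory Defs
  imports "HOL-Analysis.Analysis"
begin

definition ctranspose :: "complex ^ 'n ^ 'm \<Rightarrow> complex ^ 'm ^ 'n" where
  "ctranspose A = (\<chi> i j. cnj (A $ j $ i))"

definition hermitian :: "complex ^ 'n ^ 'n \<Rightarrow> bool" where
  "hermitian A \<longleftrightarrow> ctranspose A = A"

definition unitary :: "complex ^ 'n ^ 'n \<Rightarrow> bool" where
  "unitary U \<longleftrightarrow> U ** ctranspose U = mat 1 \<and> ctranspose U ** U = mat 1"

text \<open>For hermitian \<open>A\<close> the quadratic form \<open>x\<^sup>* A x\<close> is real, so taking the real part loses nothing.\<close>

definition psd_mats :: "(complex ^ 'n ^ 'n) set" where
  "psd_mats = {A. hermitian A \<and> (\<forall>x. 0 \<le> Re (\<Sum>i\<in>UNIV. cnj (x $ i) * (A *v x) $ i))}"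

text \<open>The multiplication that the library puts on vectors is componentwise, hence on matrices
  it is the Schur product (and not the matrix product, which is \<open>**\<close>).\<close>

abbreviation schur_prod :: "complex ^ 'n ^ 'n \<Rightarrow> complex ^ 'n ^ 'n \<Rightarrow> complex ^ 'n ^ 'n"
    (infixl "\<circ>\<^sub>S" 70) where
  "A \<circ>\<^sub>S Z \<equiv> A * Z"

lemma schur_prod_nth: "(A \<circ>\<^sub>S Z) $ i $ j = A $ i $ j * Z $ i $ j"
  by simp

text \<open>A functional on positive semidefinite matrices is represented by a function on all matrices
  whose values outside \<^const>\<open>psd_mats\<close> are unconstrained.\<close>

definition symmetric_anti_norm :: "(complex ^ 'n ^ 'n \<Rightarrow> real) \<Rightarrow> bool" where
  "symmetric_anti_norm N \<longleftrightarrow>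
     (\<forall>A\<in>psd_mats. 0 \<le> N A) \<and>
     continuous_on psd_mats N \<and>
     (\<forall>A\<in>psd_mats. \<forall>c\<ge>0. N (c *\<^sub>R A) = c * N A) \<and>
     (\<forall>A\<in>psd_mats. \<forall>U. unitary U \<longrightarrow> N A = N (U ** A ** ctranspose U)) \<and>
     (\<forall>A\<in>psd_mats. \<forall>B\<in>psd_mats. N A + N B \<le> N (A + B))"

end

theory Submission
  imports Defs
begin

text \<open>
  Let \<open>s\<^sub>i\<close> be the square root of the diagonal entry \<open>A\<^sub>i\<^sub>i\<close> and let \<open>D\<close> be the diagonal matrix of the
  \<open>s\<^sub>i\<close>. Then \<open>A = D C D\<close>, where \<open>C\<close> is a correlation matrix (positive semidefinite with unit
  diagonal), and the Schur product becomes \<open>A \<circ> Z = C \<circ> (D Z D)\<close>. So there are two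
  inequalities to prove.

  \<^emph>\<open>Diagonal congruence\<close> (\<open>anti_norm_diag_congruence\<close>): \<open>N (D Z D) \<ge> N Z\<close>.
  Write \<open>Z = R R\<^sup>*\<close>. The matrices \<open>K K\<^sup>*\<close> and \<open>K\<^sup>* K\<close> are unitarily similar, so \<open>N (D Z D)\<close> is
  \<open>N (R\<^sup>* D\<^sup>2 R)\<close> and \<open>N Z\<close> is \<open>N (R\<^sup>* R)\<close>. The difference \<open>R\<^sup>* (D\<^sup>2 - 1) R\<close> is positive
  semidefinite, and superadditivity together with \<open>N \<ge> 0\<close> makes \<open>N\<close> monotone.

  \<^emph>\<open>Schur product with a correlation matrix\<close>: \<open>N (C \<circ> Y) \<ge> N Y\<close>. The map
  \<open>Y \<mapsto> C \<circ> Y\<close> is positive, unital and trace preserving, so the spectrum of \<open>C \<circ> Y\<close> is majorized by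
  that of \<open>Y\<close>; equivalently, \<open>C \<circ> Y\<close> lies in the convex hull of the unitary orbit of \<open>Y\<close>
  (\<open>schur_correlation_in_unitary_hull\<close>). On this hull \<open>N\<close> is at least \<open>N Y\<close>, since \<open>N\<close> is concave
  and constant on the orbit (\<open>anti_norm_unitary_hull\<close>). Membership in the hull is shown by separation:
  a hermitian \<open>H\<close> separating \<open>C \<circ> Y\<close> from the hull would have
  \<open>tr (H (C \<circ> Y)) > tr (H U Y U\<^sup>*)\<close> for all unitary \<open>U\<close>. In eigenbases of \<open>H\<close> and \<open>Y\<close> the left side
  is a sum of products of eigenvalues weighted by a doubly stochastic matrix, hence at most the sum
  of the products of equally ordered eigenvalues, and the right side attains that value.

  The two facts of linear algebra used here, the spectral theorem with eigenvalues in a prescribed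
  order and the similarity of \<open>K K\<^sup>*\<close> and \<open>K\<^sup>* K\<close>, both come from maximizing a trace functional over
  the compact set of unitary matrices and comparing the maximizer with its products by the unitaries
  \<open>1 + (w - 1) v v\<^sup>*\<close>.
\<close>

section \<open>Matrix algebra\<close>

lemma ctranspose_nth [simp]: "ctranspose A $ i $ j = cnj (A $ j $ i)"
  by (simp add: ctranspose_def)

lemma ctranspose_ctranspose [simp]: "ctranspose (ctranspose A) = A"
  by (simp add: vec_eq_iff)

lemma ctranspose_mult: "ctranspose (A ** B) = ctranspose B ** ctranspose A"
  by (simp add: vec_eq_iff matrix_matrix_mult_def mult.commute)

lemma ctranspose_add: "ctranspose (A + B) = ctranspose A + ctranspose B"
  by (simp add: vec_eq_iff)

lemma ctranspose_mat_1 [simp]: "ctranspose (mat 1) = mat 1"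
  by (auto simp: vec_eq_iff mat_def)

lemma unitary_mult: "unitary U \<Longrightarrow> unitary V \<Longrightarrow> unitary (U ** V)"
  by (simp add: unitary_def ctranspose_mult)
    (metis matrix_mul_assoc matrix_mul_rid)

lemma unitary_ctranspose: "unitary U \<Longrightarrow> unitary (ctranspose U)"
  unfolding unitary_def by simp

lemma unitary_mat_1: "unitary (mat 1)"
  unfolding unitary_def by simp

lemma unitary_inverse:
  assumes "unitary U"
  shows "U ** ctranspose U = mat 1" and "ctranspose U ** U = mat 1"
  using assms by (simp_all add: unitary_def)

lemma unitary_cancel:
  assumes "unitary U"
  shows "U ** (ctranspose U ** A) = A" and "ctranspose U ** (U ** A) = A"
  using unitary_inverse[OF assms] by (simp_all add: matrix_mul_assoc)

lemma hermitian_nth: "hermitian A \<Longrightarrow> cnj (A $ j $ i) = A $ i $ j"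
  unfolding hermitian_def by (metis ctranspose_nth)

text \<open>The Euclidean inner product on matrices is the real trace form; this turns a separating
  hyperplane into a linear functional given by a matrix.\<close>

lemma inner_matrix_trace: "inner A B = Re (trace (ctranspose A ** B))"
  for A B :: "complex ^ 'n ^ 'n"
proof -
  have "Re (trace (ctranspose A ** B)) = (\<Sum>i\<in>UNIV. \<Sum>j\<in>UNIV. inner (A $ j $ i) (B $ j $ i))"
    by (simp add: trace_def matrix_matrix_mult_def inner_complex_def)
  also have "\<dots> = (\<Sum>j\<in>UNIV. \<Sum>i\<in>UNIV. inner (A $ j $ i) (B $ j $ i))"
    by (rule sum.swap)
  finally show ?thesis
    by (simp add: inner_vec_def)
qed

definition cdot :: "complex ^ 'n \<Rightarrow> complex ^ 'n \<Rightarrow> complex" where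
  "cdot x y = (\<Sum>i\<in>UNIV. cnj (x $ i) * y $ i)"

lemma psd_mats_iff: "A \<in> psd_mats \<longleftrightarrow> hermitian A \<and> (\<forall>x. 0 \<le> Re (cdot x (A *v x)))"
  unfolding psd_mats_def cdot_def by simp

lemma cdot_self: "cdot x x = of_real ((norm x)\<^sup>2)"
proof -
  have "cdot x x = (\<Sum>i\<in>UNIV. of_real ((norm (x $ i))\<^sup>2))"
    unfolding cdot_def by (simp only: complex_norm_square mult.commute)
  also have "\<dots> = of_real ((norm x)\<^sup>2)"
    by (simp add: norm_vec_def L2_set_def sum_nonneg)
  finally show ?thesis .
qed

lemma cdot_mult_vec: "cdot x (A *v y) = cdot (ctranspose A *v x) y"
proof -
  have "cdot x (A *v y) = (\<Sum>i\<in>UNIV. \<Sum>j\<in>UNIV. cnj (x $ i) * (A $ i $ j * y $ j))"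
    by (simp add: cdot_def matrix_vector_mult_def sum_distrib_left)
  also have "\<dots> = (\<Sum>j\<in>UNIV. \<Sum>i\<in>UNIV. cnj (x $ i) * (A $ i $ j * y $ j))"
    by (rule sum.swap)
  also have "\<dots> = cdot (ctranspose A *v x) y"
    by (simp add: cdot_def matrix_vector_mult_def sum_distrib_left sum_distrib_right mult_ac)
  finally show ?thesis .
qed

lemma cdot_commute: "cdot y x = cnj (cdot x y)"
  by (simp add: cdot_def mult.commute)

lemma cdot_scale: "cdot (a *s x) (b *s y) = cnj a * b * cdot x y"
  by (simp add: cdot_def sum_distrib_left mult_ac)

lemma hermitian_form_real:
  assumes "hermitian A"
  shows "Im (cdot x (A *v x)) = 0"
proof -
  have "cdot x (A *v x) = cnj (cdot x (A *v x))"
    using assms cdot_mult_vec[of x A x] unfolding hermitian_def by (metis cdot_commute)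
  then show ?thesis
    by (metis complex_cnj complex.sel(2) complex_surj equal_neg_zero)
qed

lemma cdot_axis: "cdot (axis i 1) (A *v axis i 1) = A $ i $ i"
  unfolding cdot_def matrix_vector_mult_def axis_def
  by (simp add: if_distrib if_distribR cong: if_cong)

lemma cdot_two_axes:
  assumes "p \<noteq> q"
  shows "cdot (axis p 1 + axis q z) (A *v (axis p 1 + axis q z)) =
    A $ p $ p + z * A $ p $ q + cnj z * A $ q $ p + cnj z * z * A $ q $ q"
proof -
  have *: "A *v axis k y = (\<chi> i. A $ i $ k * y)" for k y
    unfolding matrix_vector_mult_def axis_def
    by (simp add: vec_eq_iff if_distrib if_distribR cong: if_cong)
  have **: "cdot (axis k y) w = cnj y * w $ k" for k y w
    unfolding cdot_def axis_def
    by (simp add: if_distrib if_distribR cong: if_cong)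
  have "cdot (x + y) w = cdot x w + cdot y w" for x y w :: "complex ^ 'a"
    by (simp add: cdot_def sum.distrib algebra_simps)
  then show ?thesis
    using assms by (simp add: * ** matrix_vector_right_distrib algebra_simps)
qed

text \<open>Over the complex numbers the quadratic form determines the matrix by polarization, so reality
  of the form is enough. Extremality of a unitary gives exactly this kind of information, and only on
  unit vectors.\<close>

lemma hermitian_if_form_real:
  assumes "\<And>v. norm v = 1 \<Longrightarrow> Im (cdot v (A *v v)) = 0"
  shows "hermitian A"
proof -
  have all: "Im (cdot v (A *v v)) = 0" for v
  proof (cases "v = 0")
    case False
    define u where "u = complex_of_real (1 / norm v) *s v"
    have "complex_of_real ((norm u)\<^sup>2) = of_real ((1 / norm v)\<^sup>2 * (norm v)\<^sup>2)"
      by (simp only: cdot_self[symmetric] u_def cdot_scale)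
        (simp add: cdot_self power2_eq_square)
    then have "norm u = 1"
      using False unfolding of_real_eq_iff
      by (metis abs_norm_cancel divide_self_if mult_1 norm_eq_zero power_mult_distrib power_one
          real_sqrt_abs real_sqrt_one times_divide_eq_left)
    then have "Im (cdot u (A *v u)) = 0" by (rule assms)
    moreover have "cdot u (A *v u) = of_real ((1 / norm v)\<^sup>2) * cdot v (A *v v)"
      unfolding u_def by (simp add: vector_scalar_commute cdot_scale power2_eq_square)
    ultimately show ?thesis using False by simp
  qed (simp add: cdot_def)
  have d: "Im (A $ k $ k) = 0" for k
    using all[of "axis k 1"] by (simp add: cdot_axis)
  have "cnj (A $ q $ p) = A $ p $ q" for p q
  proof (cases "p = q")
    case True
    then show ?thesis using d[of p] by (simp add: complex_eq_iff)
  next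
    case False
    \<comment> \<open>The vectors \<open>e\<^sub>p + e\<^sub>q\<close> and \<open>e\<^sub>p + \<i> e\<^sub>q\<close> see the imaginary part of
      \<open>A\<^sub>p\<^sub>q + A\<^sub>q\<^sub>p\<close> and the real part of \<open>A\<^sub>p\<^sub>q - A\<^sub>q\<^sub>p\<close>.\<close>
    show ?thesis
      using all[of "axis p 1 + axis q 1"] all[of "axis p 1 + axis q \<i>"] d[of p] d[of q]
      unfolding cdot_two_axes[OF False] by (simp add: complex_eq_iff)
  qed
  then show ?thesis unfolding hermitian_def by (simp add: vec_eq_iff)
qed

definition outer :: "complex ^ 'n \<Rightarrow> complex ^ 'm \<Rightarrow> complex ^ 'm ^ 'n" where
  "outer x y = (\<chi> i j. x $ i * cnj (y $ j))"

lemma matrix_mult_outer: "A ** outer x y = outer (A *v x) y"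
  by (simp add: vec_eq_iff outer_def matrix_matrix_mult_def matrix_vector_mult_def
      sum_distrib_left sum_distrib_right mult_ac)

lemma outer_mult_outer: "outer x y ** outer z w = outer (cdot y z *s x) w"
  by (simp add: vec_eq_iff outer_def matrix_matrix_mult_def cdot_def
      sum_distrib_right sum_distrib_left mult_ac)

lemma trace_outer: "trace (outer x y) = cdot y x"
  by (simp add: trace_def outer_def cdot_def mult.commute)

lemma trace_mult_outer: "trace (A ** outer (a *s x) y) = a * cdot y (A *v x)"
  by (simp add: matrix_mult_outer trace_outer vector_scalar_commute cdot_def sum_distrib_left mult_ac)

lemma matrix_add_rdistrib: "(A + B) ** C = A ** C + B ** C"
  for A B :: "complex ^ 'n ^ 'm"
  by (simp add: vec_eq_iff matrix_matrix_mult_def sum.distrib algebra_simps)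

section \<open>Extremal unitaries\<close>

text \<open>For a unit vector \<open>v\<close> this is \<open>1 + (w - 1) v v\<^sup>*\<close>, which multiplies the component along \<open>v\<close> by
  the phase \<open>w\<close> and fixes the orthogonal complement. Testing a maximizer against this family yields
  information on the quadratic form at every unit vector \<open>v\<close>; for \<open>w = -1\<close> it is a Householder
  reflection.\<close>

definition phase_shift :: "complex ^ 'n \<Rightarrow> complex \<Rightarrow> complex ^ 'n ^ 'n" where
  "phase_shift v w = mat 1 + outer ((w - 1) *s v) v"

lemma ctranspose_phase_shift: "ctranspose (phase_shift v w) = phase_shift v (cnj w)"
  by (auto simp: vec_eq_iff phase_shift_def outer_def mat_def algebra_simps)

lemma phase_shift_mult:
  assumes "norm v = 1"
  shows "phase_shift v w ** phase_shift v z = phase_shift v (w * z)"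
proof -
  have *: "cdot v (b *s v) = b" for b
    using cdot_scale[of 1 v b v] assms by (simp add: cdot_self)
  have "phase_shift v w ** phase_shift v z =
      mat 1 + outer ((w - 1) *s v) v + (outer ((z - 1) *s v) v + outer ((z - 1) *s ((w - 1) *s v)) v)"
    unfolding phase_shift_def matrix_add_ldistrib matrix_add_rdistrib outer_mult_outer
    by (simp only: * matrix_mul_lid matrix_mul_rid)
  also have "\<dots> = phase_shift v (w * z)"
    by (simp add: phase_shift_def vec_eq_iff outer_def algebra_simps)
  finally show ?thesis .
qed

lemma unitary_phase_shift:
  assumes "norm v = 1" "norm w = 1"
  shows "unitary (phase_shift v w)"
proof -
  have "w * cnj w = 1"
    using assms(2) using complex_norm_square[of w] by simp
  moreover have "phase_shift v 1 = mat 1"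
    by (simp add: phase_shift_def outer_def vec_eq_iff)
  ultimately show ?thesis
    unfolding unitary_def ctranspose_phase_shift
    by (simp add: phase_shift_mult[OF assms(1)] mult.commute)
qed

text \<open>Take for \<open>w\<close> the phase that rotates \<open>z\<close> to \<open>\<bar>z\<bar>\<close>: the hypothesis then reads
  \<open>\<bar>z\<bar> \<le> Re z\<close>.\<close>

lemma complex_real_nonneg_if_phase_extremal:
  assumes "\<And>w. norm w = 1 \<Longrightarrow> Re ((w - 1) * z) \<le> 0"
  shows "Im z = 0" and "0 \<le> Re z"
proof -
  have "norm z \<le> Re z"
  proof (cases "z = 0")
    case False
    have "Re ((cnj z / of_real (norm z) - 1) * z) \<le> 0"
      using False by (intro assms) (simp add: norm_divide)
    moreover have "(cnj z / of_real (norm z)) * z = of_real (norm z)"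
      using False complex_norm_square[of z] by (simp add: power2_eq_square field_simps)
    ultimately show ?thesis
      by (simp only: left_diff_distrib minus_complex.sel Re_complex_of_real) simp
  qed simp
  moreover from this have "Re z = norm z"
    using complex_Re_le_cmod[of z] by simp
  ultimately show "Im z = 0" "0 \<le> Re z"
    using cmod_power2[of z] by auto
qed

lemma continuous_on_ctranspose [continuous_intros]:
  fixes f :: "'a::topological_space \<Rightarrow> complex ^ 'n ^ 'm"
  assumes "continuous_on S f"
  shows "continuous_on S (\<lambda>x. ctranspose (f x))"
  unfolding ctranspose_def
  by (intro continuous_intros assms)

lemma continuous_on_matrix_mult [continuous_intros]:
  fixes f :: "'a::topological_space \<Rightarrow> complex ^ 'n ^ 'm"
    and g :: "'a::topological_space \<Rightarrow> complex ^ 'k ^ 'n"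
  assumes "continuous_on S f" "continuous_on S g"
  shows "continuous_on S (\<lambda>x. f x ** g x)"
  unfolding matrix_matrix_mult_def
  by (intro continuous_intros assms)

lemma compact_unitary: "compact {U :: complex ^ 'n ^ 'n. unitary U}"
proof -
  have "norm U = sqrt (real CARD('n))" if "unitary U" for U :: "complex ^ 'n ^ 'n"
    using that inner_matrix_trace[of U U] unfolding unitary_def norm_eq_sqrt_inner
    by (simp add: trace_def mat_def)
  then have "bounded {U :: complex ^ 'n ^ 'n. unitary U}"
    by (auto simp: bounded_iff intro!: exI[of _ "sqrt (real CARD('n))"])
  moreover have "closed {U :: complex ^ 'n ^ 'n. unitary U}"
    unfolding unitary_def
    by (intro closed_Collect_conj closed_Collect_eq continuous_intros)
  ultimately show ?thesis
    by (simp add: compact_eq_bounded_closed)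
qed

lemma unitary_maximizer:
  fixes f :: "complex ^ 'n ^ 'n \<Rightarrow> real"
  assumes "continuous_on UNIV f"
  obtains U where "unitary U" "\<And>V. unitary V \<Longrightarrow> f V \<le> f U"
proof -
  have "{U :: complex ^ 'n ^ 'n. unitary U} \<noteq> {}"
    using unitary_mat_1 by blast
  then obtain U where "unitary U" "\<forall>V\<in>{V. unitary V}. f V \<le> f U"
    using continuous_attains_sup[OF compact_unitary, of f] continuous_on_subset[OF assms] by auto
  then show thesis by (auto intro: that)
qed

text \<open>A weak polar decomposition: the \<open>U\<close> that maximizes \<open>Re tr (U K)\<close> works, because with
  \<open>M = U K\<close> the phase shifts change the trace by \<open>(w - 1) v\<^sup>* M v\<close>, which cannot have positive real
  part for any phase \<open>w\<close>.\<close>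

lemma unitary_mult_hermitian:
  fixes K :: "complex ^ 'n ^ 'n"
  obtains U where "unitary U" "hermitian (U ** K)"
proof -
  have "continuous_on UNIV (\<lambda>U :: complex ^ 'n ^ 'n. Re (trace (U ** K)))"
    unfolding trace_def by (intro continuous_intros)
  then obtain U where U: "unitary U"
    and max: "\<And>V. unitary V \<Longrightarrow> Re (trace (V ** K)) \<le> Re (trace (U ** K))"
    by (rule unitary_maximizer) blast
  have "hermitian (U ** K)"
  proof (rule hermitian_if_form_real)
    fix v :: "complex ^ 'n" assume v: "norm v = 1"
    let ?M = "U ** K"
    have "Re ((w - 1) * cdot v (?M *v v)) \<le> 0" if "norm w = 1" for w
    proof -
      have "trace (phase_shift v w ** ?M) = trace (?M ** phase_shift v w)"
        by (rule trace_mul_sym)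
      also have "\<dots> = trace ?M + (w - 1) * cdot v (?M *v v)"
        unfolding phase_shift_def matrix_add_ldistrib trace_add trace_mult_outer by simp
      finally show ?thesis
        using max[OF unitary_mult[OF unitary_phase_shift[OF v that] U]]
        by (simp add: matrix_mul_assoc)
    qed
    then show "Im (cdot v (?M *v v)) = 0"
      by (rule complex_real_nonneg_if_phase_extremal(1))
  qed
  with U show thesis by (rule that)
qed

text \<open>With \<open>P = U K\<close> hermitian, \<open>K\<^sup>* K = P\<^sup>* P = P P\<^sup>* = U K K\<^sup>* U\<^sup>*\<close>.\<close>

lemma mult_ctranspose_unitarily_similar:
  fixes K :: "complex ^ 'n ^ 'n"
  obtains W where "unitary W" "K ** ctranspose K = W ** (ctranspose K ** K) ** ctranspose W"
proof -
  obtain U where U: "unitary U" and h: "hermitian (U ** K)"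
    by (rule unitary_mult_hermitian)
  have "ctranspose K ** ctranspose U = U ** K"
    using h unfolding hermitian_def ctranspose_mult .
  then have "(ctranspose K ** ctranspose U) ** (U ** K) = (U ** K) ** (ctranspose K ** ctranspose U)"
    by simp
  then have "ctranspose K ** K = U ** (K ** (ctranspose K ** ctranspose U))"
    using U by (simp add: matrix_mul_assoc[symmetric] unitary_cancel)
  then have "K ** ctranspose K = ctranspose U ** (ctranspose K ** K) ** U"
    using U by (simp add: matrix_mul_assoc[symmetric] unitary_cancel unitary_inverse)
  then show thesis
    using that[of "ctranspose U"] U by (simp add: unitary_ctranspose)
qed

definition diag :: "('n \<Rightarrow> real) \<Rightarrow> complex ^ 'n ^ 'n" where
  "diag d = (\<chi> i j. if i = j then of_real (d i) else 0)"

lemma diag_mult_nth: "(diag d ** A) $ i $ j = of_real (d i) * A $ i $ j"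
  unfolding diag_def matrix_matrix_mult_def
  by (simp add: if_distrib if_distribR cong: if_cong)

lemma mult_diag_nth: "(A ** diag d) $ i $ j = A $ i $ j * of_real (d j)"
  unfolding diag_def matrix_matrix_mult_def
  by (simp add: if_distrib if_distribR cong: if_cong)

lemma ctranspose_diag [simp]: "ctranspose (diag d) = diag d"
  by (auto simp: vec_eq_iff diag_def)

lemma hermitian_diag: "hermitian (diag d)"
  by (simp add: hermitian_def)

lemma diag_mult_diag: "diag c ** diag d = diag (\<lambda>i. c i * d i)"
  by (simp add: vec_eq_iff diag_mult_nth) (simp add: diag_def)

lemma hermitian_conj: "hermitian A \<Longrightarrow> hermitian (U ** A ** ctranspose U)"
  by (simp add: hermitian_def ctranspose_mult matrix_mul_assoc)

text \<open>Maximize \<open>Re tr (U A U\<^sup>* diag c)\<close> over the unitaries and put \<open>M = U A U\<^sup>*\<close> at a maximum.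
  A phase shift along a unit vector \<open>v\<close> changes the functional by twice the real part of \<open>(w - 1) z\<close> with
  \<open>z = v\<^sup>* M (diag c) v - (v\<^sup>* M v) (v\<^sup>* (diag c) v)\<close>, so \<open>z\<close> is real and nonnegative. Reality makes
  \<open>M (diag c)\<close> hermitian, that is, \<open>M\<close> commutes with \<open>diag c\<close>, and injectivity of \<open>c\<close> makes \<open>M\<close>
  diagonal. Nonnegativity at \<open>v = (e\<^sub>i + e\<^sub>j) / \<surd>2\<close> says that the eigenvalues are ordered as \<open>c\<close>.
  Using one \<open>c\<close> for several matrices therefore orders all their spectra alike, without any order on
  the index type.\<close>

lemma spectral_decomposition_sorted:
  fixes A :: "complex ^ 'n ^ 'n" and c :: "'n \<Rightarrow> real"
  assumes A: "hermitian A" and c: "inj c"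
  obtains U d where "unitary U" "A = ctranspose U ** diag d ** U"
    "\<And>i j. 0 \<le> (c i - c j) * (d i - d j)"
proof -
  have "continuous_on UNIV (\<lambda>U. Re (trace (U ** A ** ctranspose U ** diag c)))"
    unfolding trace_def by (intro continuous_intros)
  then obtain U where U: "unitary U"
    and max: "\<And>V. unitary V \<Longrightarrow> Re (trace (V ** A ** ctranspose V ** diag c))
                                \<le> Re (trace (U ** A ** ctranspose U ** diag c))"
    by (rule unitary_maximizer) blast
  define M where "M = U ** A ** ctranspose U"
  have M: "hermitian M"
    unfolding M_def using A by (rule hermitian_conj)
  define r where "r v = Re (cdot v (M *v v)) * Re (cdot v (diag c *v v))" for v
  define q where "q v = cdot v ((M ** diag c) *v v)" for v
  have ext: "Im (q v) = 0 \<and> r v \<le> Re (q v)" if v: "norm v = 1" for v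
  proof -
    have "Re ((w - 1) * (q v - of_real (r v))) \<le> 0" if w: "norm w = 1" for w
    proof -
      let ?P = "outer ((w - 1) *s v) v" and ?Q = "outer ((cnj w - 1) *s v) v"
      have G: "phase_shift v w = mat 1 + ?P" "ctranspose (phase_shift v w) = mat 1 + ?Q"
        by (simp_all only: ctranspose_phase_shift) (simp_all only: phase_shift_def)
      have t1: "trace (?P ** M ** diag c) = (w - 1) * q v"
      proof -
        have "trace (?P ** M ** diag c) = trace ((M ** diag c) ** ?P)"
          using trace_mul_sym[of ?P "M ** diag c"] by (simp only: matrix_mul_assoc)
        then show ?thesis by (simp only: trace_mult_outer q_def)
      qed
      have t2: "trace (M ** ?Q ** diag c) = (cnj w - 1) * cnj (q v)"
      proof -
        have "trace (M ** ?Q ** diag c) = trace ((diag c ** M) ** ?Q)"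
          using trace_mul_sym[of "M ** ?Q" "diag c"] by (simp only: matrix_mul_assoc)
        also have "\<dots> = (cnj w - 1) * cdot v ((diag c ** M) *v v)"
          by (simp only: trace_mult_outer)
        also have "cdot v ((diag c ** M) *v v) = cnj (q v)"
          using M cdot_mult_vec[of v "diag c ** M" v] cdot_commute[of "(M ** diag c) *v v" v]
          by (simp add: q_def ctranspose_mult hermitian_def)
        finally show ?thesis .
      qed
      have re: "of_real (r v) = cdot v (M *v v) * cdot v (diag c *v v)"
        using hermitian_form_real[OF M, of v] hermitian_form_real[OF hermitian_diag, of v c]
        unfolding r_def by (simp add: complex_eq_iff)
      have t3: "trace (?P ** M ** ?Q ** diag c) = (w - 1) * (cnj w - 1) * of_real (r v)"
      proof -
        have "?P ** M ** ?Q ** diag c = ?P ** outer (M *v ((cnj w - 1) *s v)) v ** diag c"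
          by (simp only: matrix_mult_outer[symmetric] matrix_mul_assoc)
        then have "trace (?P ** M ** ?Q ** diag c)
            = trace (diag c ** outer (cdot v (M *v ((cnj w - 1) *s v)) *s ((w - 1) *s v)) v)"
          using trace_mul_sym[of "?P ** outer (M *v ((cnj w - 1) *s v)) v" "diag c"]
          by (simp only: outer_mult_outer)
        also have "\<dots> = cdot v (M *v ((cnj w - 1) *s v)) * (w - 1) * cdot v (diag c *v v)"
          by (simp only: trace_mult_outer vector_smult_assoc)
        also have "cdot v (M *v ((cnj w - 1) *s v)) = (cnj w - 1) * cdot v (M *v v)"
          using cdot_scale[of 1 v "cnj w - 1" "M *v v"]
          by (simp only: vector_scalar_commute vector_smult_lid complex_cnj_one mult_1)
        finally show ?thesis by (simp add: re mult_ac)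
      qed
      let ?G = "phase_shift v w"
      have "trace (?G ** M ** ctranspose ?G ** diag c) =
          trace (M ** diag c) + trace (?P ** M ** diag c) + trace (M ** ?Q ** diag c)
            + trace (?P ** M ** ?Q ** diag c)"
        unfolding G(2) unfolding G(1)
        by (simp only: matrix_add_ldistrib matrix_add_rdistrib trace_add matrix_mul_lid matrix_mul_rid
            add_ac)
      also have "\<dots> = trace (M ** diag c) + (w - 1) * q v + (cnj w - 1) * cnj (q v)
          + (w - 1) * (cnj w - 1) * of_real (r v)"
        by (simp only: t1 t2 t3)
      finally have "Re (trace (?G ** M ** ctranspose ?G ** diag c)) - Re (trace (M ** diag c))
          = 2 * Re ((w - 1) * q v) + Re ((w - 1) * (cnj w - 1)) * r v"
        by simp
      also have "Re ((w - 1) * (cnj w - 1)) = 2 * (1 - Re w)"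
        using cmod_power2[of w] w by (simp add: algebra_simps power2_eq_square)
      finally have "Re (trace (?G ** M ** ctranspose ?G ** diag c)) - Re (trace (M ** diag c))
          = 2 * Re ((w - 1) * (q v - of_real (r v)))"
        by (simp add: algebra_simps)
      moreover have "Re (trace (?G ** M ** ctranspose ?G ** diag c)) \<le> Re (trace (M ** diag c))"
        using max[OF unitary_mult[OF unitary_phase_shift[OF v w] U]]
        by (simp add: M_def ctranspose_mult matrix_mul_assoc)
      ultimately show ?thesis by simp
    qed
    from complex_real_nonneg_if_phase_extremal[OF this] show ?thesis by simp
  qed
  have "hermitian (M ** diag c)"
    using ext unfolding q_def by (intro hermitian_if_form_real) blast
  have off: "M $ i $ j = 0" if "i \<noteq> j" for i j
  proof -
    have "M $ i $ j * of_real (c j) = M $ i $ j * of_real (c i)"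
      using hermitian_nth[OF \<open>hermitian (M ** diag c)\<close>, of j i] hermitian_nth[OF M, of j i]
      by (auto simp: mult_diag_nth)
    then show ?thesis using that c by (auto dest: injD)
  qed
  define d where "d i = Re (M $ i $ i)" for i
  have "Im (M $ i $ i) = 0" for i
    using hermitian_nth[OF M, of i i] by (simp add: complex_eq_iff)
  then have Md: "M = diag d"
    using off by (auto simp: vec_eq_iff diag_def d_def complex_eq_iff)
  have "0 \<le> (c i - c j) * (d i - d j)" for i j
  proof (cases "i = j")
    case False
    let ?u = "axis i 1 + axis j 1 :: complex ^ 'n"
    define v where "v = complex_of_real (1 / sqrt 2) *s ?u"
    have half: "complex_of_real (1 / sqrt 2) * complex_of_real (1 / sqrt 2) = 1 / 2"
      by (metis of_real_mult of_real_divide of_real_1 of_real_numeral times_divide_times_eq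
          mult_1 real_sqrt_mult_self abs_numeral)
    have form: "cdot v (diag e *v v) = of_real ((e i + e j) / 2)" for e :: "'n \<Rightarrow> real"
      unfolding v_def vector_scalar_commute cdot_scale
      unfolding cdot_two_axes[OF False] complex_cnj_complex_of_real half
      using False by (simp add: diag_def)
    have "of_real ((norm v)\<^sup>2) = cdot v (diag (\<lambda>_. 1) *v v)"
      using cdot_self[of v] by (simp add: diag_def mat_def[symmetric])
    also have "\<dots> = 1" unfolding form by simp
    finally have "(norm v)\<^sup>2 = 1" by (metis of_real_eq_1_iff)
    then have "norm v = 1" using power2_eq_imp_eq[of "norm v" 1] by simp
    from ext[OF this] have "(d i + d j) / 2 * ((c i + c j) / 2) \<le> (d i * c i + d j * c j) / 2"
      unfolding r_def q_def Md diag_mult_diag form by simp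
    then show ?thesis by (simp add: field_simps)
  qed simp
  moreover have "A = ctranspose U ** diag d ** U"
    using U unfolding Md[symmetric] M_def
    by (simp add: matrix_mul_assoc[symmetric] unitary_cancel unitary_inverse)
  ultimately show thesis using that U by blast
qed

lemma finite_type_inj_real:
  obtains c :: "'n::finite \<Rightarrow> real" where "inj c"
proof -
  obtain c :: "'n \<Rightarrow> nat" where "inj c"
    using finite_imp_inj_to_nat_seg[of "UNIV :: 'n set"] by auto
  then show thesis
    by (intro that[of "\<lambda>i. real (c i)"]) (simp add: inj_on_def)
qed

section \<open>Doubly stochastic sums\<close>

text \<open>These \<open>a\<close> and \<open>b\<close> are an optimal solution of the linear program dual to the assignment problem
  with gains \<open>h\<^sub>i l\<^sub>m\<close>, for which the identity is an optimal assignment. They are built by adding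
  indices in increasing order of \<open>c\<close>: the new value \<open>a\<^sub>p = t\<close> has lower bounds \<open>h\<^sub>p l\<^sub>m - b\<^sub>m\<close> and upper
  bounds \<open>a\<^sub>i + h\<^sub>p l\<^sub>p - h\<^sub>i l\<^sub>p\<close>, and every lower bound is at most every upper bound because
  \<open>(h\<^sub>p - h\<^sub>i) (l\<^sub>p - l\<^sub>m) \<ge> 0\<close>.\<close>

lemma similarly_ordered_potentials:
  fixes c h l :: "'a \<Rightarrow> real"
  assumes "finite I" and c: "inj c"
    and h: "\<And>i j. 0 \<le> (c i - c j) * (h i - h j)"
    and l: "\<And>i j. 0 \<le> (c i - c j) * (l i - l j)"
  shows "\<exists>a b. (\<forall>i\<in>I. a i + b i = h i * l i) \<and> (\<forall>i\<in>I. \<forall>m\<in>I. h i * l m \<le> a i + b m)"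
  using \<open>finite I\<close>
proof (induction rule: finite_ranking_induct[where f = c])
  case (insert p J)
  then obtain a b where eq: "\<forall>i\<in>J. a i + b i = h i * l i"
    and le: "\<forall>i\<in>J. \<forall>m\<in>J. h i * l m \<le> a i + b m" by blast
  show ?case
  proof (cases "p \<in> J \<or> J = {}")
    case True
    then show ?thesis
    proof
      assume "J = {}"
      then show ?thesis by (intro exI[of _ "\<lambda>i. h i * l i"] exI[of _ "\<lambda>i. 0"]) simp
    qed (use eq le in \<open>auto simp: insert_absorb\<close>)
  next
    case False
    then have J: "p \<notin> J" "J \<noteq> {}" by auto
    have top: "h i \<le> h p" "l i \<le> l p" if "i \<in> J" for i
    proof -
      have "c i < c p"
        using insert.hyps(2)[OF that] J(1) that c by (metis injD order_le_less)
      then show "h i \<le> h p" "l i \<le> l p"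
        using h[of p i] l[of p i] by (simp_all add: zero_le_mult_iff)
    qed
    define t where "t = Max ((\<lambda>m. h p * l m - b m) ` J)"
    have t_ge: "h p * l m - b m \<le> t" if "m \<in> J" for m
      unfolding t_def using that \<open>finite J\<close> by simp
    have t_le: "t \<le> a i + h p * l p - h i * l p" if "i \<in> J" for i
    proof -
      have "h p * l m - b m \<le> a i + h p * l p - h i * l p" if "m \<in> J" for m
      proof -
        have "0 \<le> (h p - h i) * (l p - l m)"
          using top[OF \<open>i \<in> J\<close>] top[OF \<open>m \<in> J\<close>] by simp
        then show ?thesis using le \<open>i \<in> J\<close> \<open>m \<in> J\<close> by (fastforce simp: algebra_simps)
      qed
      then show ?thesis unfolding t_def using \<open>finite J\<close> J(2) by simp
    qed
    let ?a = "a(p := t)" and ?b = "b(p := h p * l p - t)"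
    have "\<forall>i\<in>insert p J. ?a i + ?b i = h i * l i"
      using eq J by auto
    moreover have "h i * l m \<le> ?a i + ?b m" if "i \<in> insert p J" "m \<in> insert p J" for i m
      using that le t_ge[of m] t_le[of i] by (cases "i = p"; cases "m = p") (auto simp: algebra_simps)
    ultimately show ?thesis by blast
  qed
qed simp

text \<open>The rearrangement inequality for doubly stochastic weights, by weak duality: bound \<open>h\<^sub>i l\<^sub>m\<close> by
  \<open>a\<^sub>i + b\<^sub>m\<close>, after which only the row and column sums of \<open>S\<close> matter. The potentials take the place of
  Birkhoff's theorem.\<close>

lemma doubly_stochastic_rearrangement:
  fixes S :: "'n::finite \<Rightarrow> 'n \<Rightarrow> real" and c h l :: "'n \<Rightarrow> real"
  assumes c: "inj c"
    and h: "\<And>i j. 0 \<le> (c i - c j) * (h i - h j)"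
    and l: "\<And>i j. 0 \<le> (c i - c j) * (l i - l j)"
    and nonneg: "\<And>i m. 0 \<le> S i m"
    and rows: "\<And>i. (\<Sum>m\<in>UNIV. S i m) = 1"
    and cols: "\<And>m. (\<Sum>i\<in>UNIV. S i m) = 1"
  shows "(\<Sum>i\<in>UNIV. \<Sum>m\<in>UNIV. S i m * (h i * l m)) \<le> (\<Sum>i\<in>UNIV. h i * l i)"
proof -
  obtain a b where ab: "\<And>i. a i + b i = h i * l i" "\<And>i m. h i * l m \<le> a i + b m"
    using similarly_ordered_potentials[OF finite[of UNIV] c h l] by auto
  have "(\<Sum>i\<in>UNIV. \<Sum>m\<in>UNIV. S i m * (h i * l m)) \<le> (\<Sum>i\<in>UNIV. \<Sum>m\<in>UNIV. S i m * (a i + b m))"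
    by (intro sum_mono mult_left_mono ab nonneg)
  also have "\<dots> = (\<Sum>i\<in>UNIV. \<Sum>m\<in>UNIV. S i m * a i) + (\<Sum>i\<in>UNIV. \<Sum>m\<in>UNIV. S i m * b m)"
    by (simp add: sum.distrib algebra_simps)
  also have "(\<Sum>i\<in>UNIV. \<Sum>m\<in>UNIV. S i m * b m) = (\<Sum>m\<in>UNIV. \<Sum>i\<in>UNIV. S i m * b m)"
    by (rule sum.swap)
  also have "(\<Sum>i\<in>UNIV. \<Sum>m\<in>UNIV. S i m * a i) + (\<Sum>m\<in>UNIV. \<Sum>i\<in>UNIV. S i m * b m)
      = (\<Sum>i\<in>UNIV. a i) + (\<Sum>m\<in>UNIV. b m)"
    by (simp add: sum_distrib_right[symmetric] rows cols)
  also have "\<dots> = (\<Sum>i\<in>UNIV. h i * l i)"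
    by (simp add: sum.distrib[symmetric] ab)
  finally show ?thesis .
qed

lemma conj_diag_nth:
  "(ctranspose U ** diag d ** U) $ j $ k = (\<Sum>i\<in>UNIV. of_real (d i) * (cnj (U $ i $ j) * U $ i $ k))"
proof -
  have "(ctranspose U ** diag d ** U) $ j $ k
      = (\<Sum>i\<in>UNIV. (ctranspose U ** diag d) $ j $ i * U $ i $ k)"
    by (simp add: matrix_matrix_mult_def)
  then show ?thesis by (simp add: mult_diag_nth mult_ac)
qed

lemma unitary_sum_rows:
  fixes U :: "complex ^ 'n ^ 'n"
  assumes "unitary U"
  shows "(\<Sum>m\<in>UNIV. \<Sum>j\<in>UNIV. \<Sum>k\<in>UNIV. a j k * (cnj (U $ m $ j) * U $ m $ k)) = (\<Sum>j\<in>UNIV. a j j)"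
proof -
  have on: "(\<Sum>m\<in>UNIV. cnj (U $ m $ j) * U $ m $ k) = (if j = k then 1 else 0)" for j k
  proof -
    have "(ctranspose U ** U) $ j $ k = mat 1 $ j $ k"
      using assms unfolding unitary_def by simp
    then show ?thesis by (simp add: matrix_matrix_mult_def mat_def)
  qed
  have "(\<Sum>m\<in>UNIV. \<Sum>j\<in>UNIV. \<Sum>k\<in>UNIV. a j k * (cnj (U $ m $ j) * U $ m $ k))
      = (\<Sum>j\<in>UNIV. \<Sum>m\<in>UNIV. \<Sum>k\<in>UNIV. a j k * (cnj (U $ m $ j) * U $ m $ k))"
    by (rule sum.swap)
  also have "\<dots> = (\<Sum>j\<in>UNIV. \<Sum>k\<in>UNIV. \<Sum>m\<in>UNIV. a j k * (cnj (U $ m $ j) * U $ m $ k))"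
    by (intro sum.cong refl sum.swap)
  also have "\<dots> = (\<Sum>j\<in>UNIV. a j j)"
    unfolding sum_distrib_left[symmetric] on by (simp add: if_distrib cong: if_cong)
  finally show ?thesis .
qed

lemma unitary_row_norm:
  assumes "unitary U"
  shows "(\<Sum>j\<in>UNIV. cnj (U $ m $ j) * U $ m $ j) = 1"
proof -
  have "(U ** ctranspose U) $ m $ m = mat 1 $ m $ m"
    using assms unfolding unitary_def by simp
  then show ?thesis by (simp add: matrix_matrix_mult_def mat_def mult.commute)
qed

text \<open>With \<open>v\<^sub>i\<close> and \<open>u\<^sub>m\<close> the eigenvectors, the left side is the sum of \<open>h\<^sub>i l\<^sub>m T\<^sub>i\<^sub>m\<close> for
  \<open>T\<^sub>i\<^sub>m = v\<^sub>i\<^sup>* (C \<circ> u\<^sub>m u\<^sub>m\<^sup>*) v\<^sub>i\<close>. This is the quadratic form of \<open>C\<close> at an entrywise product of the two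
  vectors, hence nonnegative. Summing over \<open>m\<close> or over \<open>i\<close> leaves only the diagonal of \<open>C\<close>, so unit
  diagonal makes \<open>T\<close> doubly stochastic.\<close>

lemma trace_schur_le:
  fixes C U V :: "complex ^ 'n ^ 'n" and c h l :: "'n \<Rightarrow> real"
  assumes C: "C \<in> psd_mats" "\<And>i. C $ i $ i = 1"
    and U: "unitary U" and V: "unitary V" and c: "inj c"
    and h: "\<And>i j. 0 \<le> (c i - c j) * (h i - h j)"
    and l: "\<And>i j. 0 \<le> (c i - c j) * (l i - l j)"
  shows "inner (ctranspose V ** diag h ** V) (C \<circ>\<^sub>S (ctranspose U ** diag l ** U))
    \<le> (\<Sum>i\<in>UNIV. h i * l i)"
proof -
  let ?H = "ctranspose V ** diag h ** V" and ?Y = "ctranspose U ** diag l ** U"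
  define x where "x i m = (\<chi> j. cnj (V $ i $ j) * U $ m $ j)" for i m
  define T where "T i m = cdot (x i m) (C *v x i m)" for i m
  have T: "T i m = (\<Sum>j\<in>UNIV. \<Sum>k\<in>UNIV.
      C $ j $ k * (V $ i $ j * cnj (V $ i $ k)) * (cnj (U $ m $ j) * U $ m $ k))" for i m
    by (simp add: T_def x_def cdot_def matrix_vector_mult_def sum_distrib_left mult_ac)
  have rows: "(\<Sum>m\<in>UNIV. T i m) = 1" for i
    unfolding T unitary_sum_rows[OF U]
    using unitary_row_norm[OF V, of i] by (simp add: C mult.commute)
  have cols: "(\<Sum>i\<in>UNIV. T i m) = 1" for m
  proof -
    have "T i m = (\<Sum>k\<in>UNIV. \<Sum>j\<in>UNIV.
      C $ j $ k * (cnj (U $ m $ j) * U $ m $ k) * (cnj (V $ i $ k) * V $ i $ j))" for i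
      unfolding T by (subst sum.swap) (simp add: mult_ac)
    then show ?thesis
      using unitary_sum_rows[OF V, of "\<lambda>k j. C $ j $ k * (cnj (U $ m $ j) * U $ m $ k)"]
        unitary_row_norm[OF U, of m] by (simp add: C)
  qed
  have nonneg: "0 \<le> Re (T i m)" for i m
    using C(1) unfolding T_def psd_mats_iff by blast
  have "inner ?H (C \<circ>\<^sub>S ?Y) = Re (\<Sum>j\<in>UNIV. \<Sum>k\<in>UNIV. cnj (?H $ j $ k) * (C $ j $ k * ?Y $ j $ k))"
    by (simp add: inner_vec_def inner_complex_def)
  also have "(\<Sum>j\<in>UNIV. \<Sum>k\<in>UNIV. cnj (?H $ j $ k) * (C $ j $ k * ?Y $ j $ k)) =
      (\<Sum>j\<in>UNIV. \<Sum>k\<in>UNIV. \<Sum>i\<in>UNIV. \<Sum>m\<in>UNIV. of_real (h i * l m) *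
        (C $ j $ k * (V $ i $ j * cnj (V $ i $ k)) * (cnj (U $ m $ j) * U $ m $ k)))"
    unfolding conj_diag_nth cnj_sum sum_distrib_left sum_distrib_right
    by (rule sum.cong[OF refl], rule sum.cong[OF refl], subst sum.swap) (simp add: mult_ac)
  also have "\<dots> = (\<Sum>j\<in>UNIV. \<Sum>i\<in>UNIV. \<Sum>k\<in>UNIV. \<Sum>m\<in>UNIV. of_real (h i * l m) *
        (C $ j $ k * (V $ i $ j * cnj (V $ i $ k)) * (cnj (U $ m $ j) * U $ m $ k)))"
    by (intro sum.cong refl sum.swap)
  also have "\<dots> = (\<Sum>i\<in>UNIV. \<Sum>j\<in>UNIV. \<Sum>k\<in>UNIV. \<Sum>m\<in>UNIV. of_real (h i * l m) *
        (C $ j $ k * (V $ i $ j * cnj (V $ i $ k)) * (cnj (U $ m $ j) * U $ m $ k)))"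
    by (rule sum.swap)
  also have "\<dots> = (\<Sum>i\<in>UNIV. \<Sum>j\<in>UNIV. \<Sum>m\<in>UNIV. \<Sum>k\<in>UNIV. of_real (h i * l m) *
        (C $ j $ k * (V $ i $ j * cnj (V $ i $ k)) * (cnj (U $ m $ j) * U $ m $ k)))"
    by (intro sum.cong refl sum.swap)
  also have "\<dots> = (\<Sum>i\<in>UNIV. \<Sum>m\<in>UNIV. \<Sum>j\<in>UNIV. \<Sum>k\<in>UNIV. of_real (h i * l m) *
        (C $ j $ k * (V $ i $ j * cnj (V $ i $ k)) * (cnj (U $ m $ j) * U $ m $ k)))"
    by (intro sum.cong refl sum.swap)
  also have "\<dots> = (\<Sum>i\<in>UNIV. \<Sum>m\<in>UNIV. of_real (h i * l m) * T i m)"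
    by (simp only: T sum_distrib_left)
  also have "Re \<dots> = (\<Sum>i\<in>UNIV. \<Sum>m\<in>UNIV. Re (T i m) * (h i * l m))"
    by (simp add: mult_ac)
  also have "\<dots> \<le> (\<Sum>i\<in>UNIV. h i * l i)"
  proof (rule doubly_stochastic_rearrangement[OF c h l nonneg])
    show "(\<Sum>m\<in>UNIV. Re (T i m)) = 1" for i using rows[of i] by (metis Re_sum one_complex.sel(1))
    show "(\<Sum>i\<in>UNIV. Re (T i m)) = 1" for m using cols[of m] by (metis Re_sum one_complex.sel(1))
  qed
  finally show ?thesis .
qed

section \<open>Positive semidefinite matrices\<close>

lemma psd_mats_add: "A \<in> psd_mats \<Longrightarrow> B \<in> psd_mats \<Longrightarrow> A + B \<in> psd_mats"
  unfolding psd_mats_iff hermitian_def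
  by (simp add: ctranspose_add matrix_vector_mult_add_rdistrib cdot_def sum.distrib distrib_left)

lemma psd_mats_scaleR: "A \<in> psd_mats \<Longrightarrow> 0 \<le> c \<Longrightarrow> c *\<^sub>R A \<in> psd_mats"
proof -
  assume A: "A \<in> psd_mats" and c: "0 \<le> c"
  have "cdot x ((c *\<^sub>R A) *v x) = c *\<^sub>R cdot x (A *v x)" for x
    by (simp add: cdot_def matrix_vector_mult_def scaleR_sum_right sum_distrib_left)
  moreover have "hermitian (c *\<^sub>R A)"
    using A unfolding psd_mats_iff hermitian_def by (simp add: vec_eq_iff)
  ultimately show ?thesis using A c by (simp add: psd_mats_iff)
qed

lemma psd_mats_conj: "A \<in> psd_mats \<Longrightarrow> B ** A ** ctranspose B \<in> psd_mats"
  unfolding psd_mats_iff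
  by (simp add: hermitian_conj matrix_vector_mul_assoc[symmetric] cdot_mult_vec[of _ B])

lemma psd_diag:
  assumes "\<And>i. 0 \<le> d i"
  shows "diag d \<in> psd_mats"
proof -
  have "(diag d *v x) $ i = of_real (d i) * x $ i" for x i
    unfolding matrix_vector_mult_def diag_def
    by (simp add: if_distrib if_distribR cong: if_cong)
  then have "cdot x (diag d *v x) = (\<Sum>i\<in>UNIV. of_real (d i * (norm (x $ i))\<^sup>2))" for x
    unfolding cdot_def by (simp add: complex_norm_square mult_ac del: of_real_power)
  then show ?thesis
    using assms by (simp add: psd_mats_iff hermitian_diag sum_nonneg)
qed

lemma psd_diag_nonneg: "A \<in> psd_mats \<Longrightarrow> 0 \<le> Re (A $ i $ i)"
  unfolding psd_mats_iff by (metis cdot_axis)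

lemma psd_gram_factor:
  fixes Z :: "complex ^ 'n ^ 'n"
  assumes "Z \<in> psd_mats"
  obtains R :: "complex ^ 'n ^ 'n" where "Z = R ** ctranspose R"
proof -
  obtain c :: "'n \<Rightarrow> real" where "inj c"
    by (rule finite_type_inj_real)
  moreover have "hermitian Z" using assms by (simp add: psd_mats_iff)
  ultimately obtain U d where U: "unitary U" and Z: "Z = ctranspose U ** diag d ** U"
    by (metis spectral_decomposition_sorted)
  have "U ** Z ** ctranspose U = diag d"
    using U unfolding Z
    by (simp add: matrix_mul_assoc[symmetric] unitary_cancel unitary_inverse)
  then have d: "0 \<le> d i" for i
    using psd_diag_nonneg[OF psd_mats_conj[OF assms, of U], of i] by (simp add: diag_def)
  have "diag d = diag (\<lambda>i. sqrt (d i)) ** diag (\<lambda>i. sqrt (d i))"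
    using d by (simp add: diag_mult_diag)
  then have "Z = (ctranspose U ** diag (\<lambda>i. sqrt (d i))) ** ctranspose (ctranspose U ** diag (\<lambda>i. sqrt (d i)))"
    unfolding Z by (simp add: ctranspose_mult matrix_mul_assoc)
  then show thesis by (rule that)
qed

section \<open>Schur products and unitary orbits\<close>

text \<open>Otherwise the closest point \<open>W\<close> of the compact convex hull gives the separating matrix
  \<open>H = C \<circ> Y - W\<close>, which is hermitian. Rotating the eigenvectors of \<open>Y\<close> onto those of \<open>H\<close> yields a point of
  the orbit on which the functional of \<open>H\<close> is at least its value at \<open>C \<circ> Y\<close>.\<close>

lemma schur_correlation_in_unitary_hull:
  fixes C Y :: "complex ^ 'n ^ 'n"
  assumes C: "C \<in> psd_mats" "\<And>i. C $ i $ i = 1" and Y: "hermitian Y"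
  shows "C \<circ>\<^sub>S Y \<in> convex hull ((\<lambda>U. U ** Y ** ctranspose U) ` {U. unitary U})" (is "?B \<in> ?K")
proof (rule ccontr)
  assume out: "?B \<notin> ?K"
  \<comment> \<open>One \<open>c\<close> serves \<open>H\<close> and \<open>Y\<close>, so that their eigenvalues are ordered alike.\<close>
  obtain c :: "'n \<Rightarrow> real" where c: "inj c"
    by (rule finite_type_inj_real)
  have orbit: "W ** Y ** ctranspose W \<in> ?K" if "unitary W" for W
    using that by (intro hull_inc) auto
  have "compact ((\<lambda>U. U ** Y ** ctranspose U) ` {U. unitary U})"
    by (intro compact_continuous_image compact_unitary continuous_intros)
  then have K: "closed ?K" "convex ?K"
    by (simp_all add: compact_convex_hull compact_imp_closed)
  define W where "W = closest_point ?K ?B"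
  define H where "H = ?B - W"
  have "?K \<noteq> {}" using orbit[OF unitary_mat_1] by blast
  then have WK: "W \<in> ?K" unfolding W_def using K(1) by (rule closest_point_in_set[rotated])
  have sep: "inner H (X - W) \<le> 0" if "X \<in> ?K" for X
    unfolding H_def W_def using closest_point_dot[OF K(2) K(1) that] .
  have "?K \<subseteq> {X. hermitian X}"
  proof (rule hull_minimal)
    show "convex {X :: complex ^ 'n ^ 'n. hermitian X}"
      unfolding convex_def hermitian_def by (simp add: vec_eq_iff)
  qed (use hermitian_conj[OF Y] in auto)
  then have "hermitian W" using WK by blast
  moreover have "hermitian ?B"
    using C(1) Y unfolding psd_mats_iff hermitian_def by (simp add: vec_eq_iff)
  ultimately have "hermitian H"
    unfolding H_def hermitian_def by (simp add: vec_eq_iff)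
  then obtain V h where V: "unitary V" and H: "H = ctranspose V ** diag h ** V"
    and h: "\<And>i j. 0 \<le> (c i - c j) * (h i - h j)"
    using c by (rule spectral_decomposition_sorted) blast
  obtain U l where U: "unitary U" and Yl: "Y = ctranspose U ** diag l ** U"
    and l: "\<And>i j. 0 \<le> (c i - c j) * (l i - l j)"
    using Y c by (rule spectral_decomposition_sorted) blast
  \<comment> \<open>The orbit element that shares the eigenvectors of \<open>H\<close>.\<close>
  let ?X = "(ctranspose V ** U) ** Y ** ctranspose (ctranspose V ** U)"
  have X: "?X = ctranspose V ** diag l ** V"
    using U unfolding Yl ctranspose_mult
    by (simp add: matrix_mul_assoc[symmetric] unitary_cancel)
  have "ctranspose H ** ?X = ctranspose H ** (ctranspose V ** diag l ** V)"
    by (simp only: X)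
  also have "\<dots> = ctranspose V ** diag (\<lambda>i. h i * l i) ** V"
    using V unfolding H ctranspose_mult diag_mult_diag[symmetric]
    by (simp add: matrix_mul_assoc[symmetric] unitary_cancel)
  also have "trace \<dots> = trace (V ** ctranspose V ** diag (\<lambda>i. h i * l i))"
    using trace_mul_sym[of "ctranspose V ** diag (\<lambda>i. h i * l i)" V] by (simp add: matrix_mul_assoc)
  also have "\<dots> = of_real (\<Sum>i\<in>UNIV. h i * l i)"
    using V by (simp add: unitary_def trace_def diag_def)
  finally have "inner H ?X = (\<Sum>i\<in>UNIV. h i * l i)"
    by (simp add: inner_matrix_trace)
  moreover have "inner H ?B \<le> (\<Sum>i\<in>UNIV. h i * l i)"
    using trace_schur_le[OF C U V c h l] by (simp add: H Yl)
  moreover have "inner H (?X - W) \<le> 0"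
    by (intro sep orbit unitary_mult unitary_ctranspose U V)
  moreover have "inner H (?B - W) > 0"
    using out WK unfolding H_def by auto
  ultimately show False by (simp add: inner_diff_right)
qed

text \<open>Homogeneity and superadditivity make \<open>N\<close> concave, so its superlevel sets are convex, and unitary
  invariance puts the orbit into the one at level \<open>N Y\<close>.\<close>

lemma anti_norm_unitary_hull:
  assumes N: "symmetric_anti_norm N" and Y: "Y \<in> psd_mats"
    and X: "X \<in> convex hull ((\<lambda>U. U ** Y ** ctranspose U) ` {U. unitary U})"
  shows "N Y \<le> N X"
proof -
  let ?S = "{X \<in> psd_mats. N Y \<le> N X}"
  have "convex ?S"
    unfolding convex_def
  proof (intro ballI allI impI)
    fix A B :: "complex ^ 'a ^ 'a" and u v :: real
    assume A: "A \<in> ?S" and B: "B \<in> ?S" and uv: "0 \<le> u" "0 \<le> v" "u + v = 1"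
    have psd: "u *\<^sub>R A \<in> psd_mats" "v *\<^sub>R B \<in> psd_mats"
      using A B uv by (auto intro: psd_mats_scaleR)
    have "N Y = u * N Y + v * N Y" using uv(3) by (simp add: distrib_right[symmetric])
    also have "\<dots> \<le> u * N A + v * N B"
      using A B uv by (intro add_mono mult_left_mono) auto
    also have "\<dots> = N (u *\<^sub>R A) + N (v *\<^sub>R B)"
      using N A B uv unfolding symmetric_anti_norm_def by simp
    also have "\<dots> \<le> N (u *\<^sub>R A + v *\<^sub>R B)"
      using N psd unfolding symmetric_anti_norm_def by blast
    finally show "u *\<^sub>R A + v *\<^sub>R B \<in> ?S"
      using psd by (simp add: psd_mats_add)
  qed
  moreover have "(\<lambda>U. U ** Y ** ctranspose U) ` {U. unitary U} \<subseteq> ?S"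
    using N Y psd_mats_conj[OF Y] unfolding symmetric_anti_norm_def by fastforce
  ultimately show ?thesis
    using X hull_minimal[of _ ?S convex] by blast
qed

text \<open>The congruence \<open>D Z D\<close> itself need not dominate \<open>Z\<close> in the semidefinite order. Swapping the
  factors of \<open>Z = R R\<^sup>*\<close> moves \<open>D\<close> to the inside, where it does: \<open>R\<^sup>* D\<^sup>2 R\<close> dominates \<open>R\<^sup>* R\<close>.\<close>

lemma anti_norm_diag_congruence:
  fixes Z :: "complex ^ 'n ^ 'n"
  assumes N: "symmetric_anti_norm N" and Z: "Z \<in> psd_mats" and s: "\<And>i. 1 \<le> s i"
  shows "N Z \<le> N (diag s ** Z ** diag s)"
proof -
  obtain R :: "complex ^ 'n ^ 'n" where R: "Z = R ** ctranspose R" using Z by (rule psd_gram_factor)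
  define K where "K = diag s ** R"
  define E where "E = diag (\<lambda>i. s i * s i - 1)"
  have gram: "ctranspose B ** B \<in> psd_mats" for B :: "complex ^ 'n ^ 'n"
    using psd_mats_conj[OF psd_diag[of "\<lambda>_. 1"], of "ctranspose B"]
    by (simp add: diag_def mat_def[symmetric])
  have swap: "N (B ** ctranspose B) = N (ctranspose B ** B)" for B :: "complex ^ 'n ^ 'n"
    using mult_ctranspose_unitarily_similar[of B] gram[of B] N
    unfolding symmetric_anti_norm_def by metis
  have "0 \<le> s i * s i - 1" for i
    using mult_mono[of 1 "s i" 1 "s i"] s[of i] by simp
  then have E: "ctranspose R ** E ** R \<in> psd_mats"
    using psd_mats_conj[OF psd_diag, of _ "ctranspose R"] unfolding E_def by simp
  have "diag (\<lambda>i. s i * s i) = mat 1 + E"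
    by (simp add: vec_eq_iff diag_def E_def mat_def)
  then have KK: "ctranspose K ** K = ctranspose R ** R + ctranspose R ** E ** R"
    unfolding K_def ctranspose_mult ctranspose_diag
    by (simp add: matrix_mul_assoc[symmetric] diag_mult_diag matrix_add_ldistrib matrix_add_rdistrib)
      (simp add: matrix_mul_assoc diag_mult_diag matrix_add_ldistrib matrix_add_rdistrib)
  have "N Z = N (ctranspose R ** R)" by (simp only: R swap)
  also have "\<dots> \<le> N (ctranspose R ** R) + N (ctranspose R ** E ** R)"
    using N E unfolding symmetric_anti_norm_def by simp
  also have "\<dots> \<le> N (ctranspose K ** K)"
    unfolding KK using N E gram unfolding symmetric_anti_norm_def by blast
  also have "\<dots> = N (diag s ** Z ** diag s)"
    unfolding swap[symmetric] by (simp add: K_def ctranspose_mult R matrix_mul_assoc)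
  finally show ?thesis .
qed

theorem theorem6p5:
  fixes A Z :: "complex ^ 'n ^ 'n"
    and N :: "complex ^ 'n ^ 'n \<Rightarrow> real"
  assumes "A \<in> psd_mats"
    and "\<And>i. 1 \<le> Re (A $ i $ i)"
    and "Z \<in> psd_mats"
    and "symmetric_anti_norm N"
  shows "N (A \<circ>\<^sub>S Z) \<ge> N Z"
proof -
  define s where "s i = sqrt (Re (A $ i $ i))" for i
  define D where "D = diag (\<lambda>i. 1 / s i)"
  define C where "C = D ** A ** D"
  define Y where "Y = diag s ** Z ** diag s"
  have s: "1 \<le> s i" for i using assms(2)[of i] by (simp add: s_def)
  have s2: "s i * s i = Re (A $ i $ i)" for i using assms(2)[of i] by (simp add: s_def)
  have s0: "s i \<noteq> 0" for i using s[of i] by linarith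
  have C: "C \<in> psd_mats"
    using psd_mats_conj[OF assms(1), of D] by (simp add: C_def D_def)
  have "A $ i $ i = of_real (s i * s i)" for i
    using assms(1) hermitian_nth[of A i i] by (simp add: psd_mats_iff s2 complex_eq_iff)
  then have C1: "C $ i $ i = 1" for i
    using s0[of i] by (simp add: C_def D_def mult_diag_nth diag_mult_nth)
  have Y: "Y \<in> psd_mats"
    using psd_mats_conj[OF assms(3), of "diag s"] by (simp add: Y_def)
  have "A \<circ>\<^sub>S Z = C \<circ>\<^sub>S Y"
    using s0 by (simp add: vec_eq_iff C_def D_def Y_def mult_diag_nth diag_mult_nth)
  moreover have "N Y \<le> N (C \<circ>\<^sub>S Y)"
    using assms(4) Y schur_correlation_in_unitary_hull[OF C C1] Y
    by (intro anti_norm_unitary_hull) (auto simp: psd_mats_iff)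
  moreover have "N Z \<le> N Y"
    unfolding Y_def using assms(4,3) s by (rule anti_norm_diag_congruence)
  ultimately show ?thesis by simp
qed

end
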